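(* Let $E=(E^0,E^1,r,s)$ be a countable directed graph and let $\pi:C^*(E)\rightarrow B(H)$ be a $*$-representation of $C^*(E)$, where $H$ is a separable Hilbert space. For $e\in E^1$ put $H_e=\pi(S_e)\pi(S_e)^*(H)$ and for $v\in E^0$ put $H_v=\pi(P_v)(H)$. Let $\{B_e\}_{e\in E^1}$, $\{B_v\}_{v\in E^0}$ and $B=\{h_j\}_{j\in\mathbb{N}}$ be orthonormal bases of the spaces $H_e$, $H_v$ and $H$, respectively, chosen such that: (i) if $0<\#s^{-1}(v)<\infty$, then $B_v=\bigcup_{e\in s^{-1}(v)}B_e$; (ii) if $\#s^{-1}(v)=\infty$, then $B_e\subseteq B_v$ for every $e\in s^{-1}(v)$; (iii) $B_v\subseteq B$ for every $v\in E^0$. Suppose in addition that $$\pi(S_e)(B_{r(e)})=B_e\quad\text{for each } e\in E^1 .$$ Then $\pi$ is unitarily equivalent to a representation $\widetilde{\pi}:C^*(E)\rightarrow B(\ell^2(\mathbb{N}))$, where $\widetilde{\pi}$ is induced by an $E$-branching system.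
   Context: A directed graph $E=(E^0,E^1,r,s)$ consists of a set of vertices $E^0$, a set of edges $E^1$, and range and source maps $r,s:E^1\to E^0$. All graphs are countable ($E^0$ and $E^1$ are countable). $C^*(E)$ is the universal C*-algebra generated by projections $\{P_v\}_{v\in E^0}$ and partial isometries $\{S_e\}_{e\in E^1}$ with orthogonal ranges such that: the $P_v$ are mutually orthogonal; $S_e^*S_e=P_{r(e)}$ for each $e\in E^1$; $S_eS_e^*\le P_{s(e)}$ for each $e\in E^1$; $P_v=\sum_{e:s(e)=v}S_eS_e^*$ for every vertex $v$ with $0<\#\{e:s(e)=v\}<\infty$. Notation: for measurable sets $A,B$ in a measure space $(X,\mu)$, $B\subseteq A$ a.e. means $\mu(B\setminus A)=0$, and $A=B$ a.e. means $\mu(A\setminus B)=\mu(B\setminus A)=0$; for maps, $f=g$ a.e. means $\mu(\{x:f(x)\ne g(x)\})=0$. An $E$-branching system is a measure space $(X,\mu)$ with families of measurable subsets $\{R_e\}_{e\in E^1}$, $\{D_v\}_{v\in E^0}$ of $X$ and maps $f_e,f_e^{-1}$ such that: 1. $R_e\cap R_d=\emptyset$ a.e. for $d\ne e$ in $E^1$; 2. $D_u\cap D_v=\emptyset$ a.e. for $u\neq v$ in $E^0$; 3. $R_e\subseteq D_{s(e)}$ a.e. for each $e\in E^1$; 4. $D_v=\bigcup_{e:s(e)=v}R_e$ a.e. if $0<\#\{e\in E^1:s(e)=v\}<\infty$; 5. for each $e\in E^1$ there is a map $f_e:D_{r(e)}\to R_e$ such that $f_e(D_{r(e)})=R_e$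 a.e. and the Radon-Nikodym derivative $\Phi_{f_e}$ of $\mu\circ f_e$ with respect to $\mu$ (in $D_{r(e)}$) exists and $\Phi_{f_e}>0$ $\mu$-a.e.; 6. for each such $f_e$ there is a map $f_e^{-1}:R_e\to D_{r(e)}$ such that $f_e\circ f_e^{-1}=\mathrm{Id}_{R_e}$ a.e. and $f_e^{-1}\circ f_e=\mathrm{Id}_{D_{r(e)}}$ a.e., and the Radon-Nikodym derivative $\Phi_{f_e^{-1}}$ of $\mu\circ f_e^{-1}$ with respect to $\mu$ (in $R_e$) exists. The representation induced by an $E$-branching system $(X,\mu)$ is the $*$-homomorphism $C^*(E)\to B(L^2(X,\mu))$ (known to exist) given by $S_e\mapsto\big(\phi\mapsto\chi_{R_e}\cdot\Phi_{f_e^{-1}}^{1/2}\cdot(\phi\circ f_e^{-1})\big)$ and $P_v\mapsto\big(\phi\mapsto\chi_{D_v}\phi\big)$. Here $\ell^2(\mathbb{N})$ is regarded as the $L^2$-space of $\mathbb{N}$ with counting measure. *)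

theory Defs
  imports "HOL-Analysis.Analysis" "Graph_Theory.Digraph"
begin

text \<open>
  Directed graphs are those of \<^theory>\<open>Graph_Theory.Digraph\<close>: the source map is \<^const>\<open>tail\<close>,
  the range map is \<^const>\<open>head\<close>, and the set of edges with source \<open>v\<close> is \<^term>\<open>out_arcs E v\<close>.
\<close>

section \<open>Complex vector spaces, C*-algebras and Hilbert spaces with explicit carriers\<close>

text \<open>
  Carriers are explicit because both \<open>L\<^sup>2(X,\<mu>)\<close> and \<open>C\<^sup>*(E)\<close> depend on terms
  (a measure, a graph) and so cannot be types.
\<close>

record 'a cvec =
  carrier :: "'a set"
  vzero :: "'a" ("\<zero>\<index>")
  vadd :: "'a \<Rightarrow> 'a \<Rightarrow> 'a" (infixl "\<oplus>\<index>" 65)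
  vscale :: "complex \<Rightarrow> 'a \<Rightarrow> 'a" (infixr "\<odot>\<index>" 75)

definition vminus :: "('a, 'm) cvec_scheme \<Rightarrow> 'a \<Rightarrow> 'a \<Rightarrow> 'a" (infixl "\<ominus>\<index>" 65)
  where "x \<ominus>\<^bsub>V\<^esub> y = x \<oplus>\<^bsub>V\<^esub> (-1) \<odot>\<^bsub>V\<^esub> y"

definition vsum :: "('a, 'm) cvec_scheme \<Rightarrow> ('i \<Rightarrow> 'a) \<Rightarrow> 'i set \<Rightarrow> 'a"
  where "vsum V f F = Finite_Set.fold (\<lambda>i. vadd V (f i)) \<zero>\<^bsub>V\<^esub> F"

locale complex_vector_space =
  fixes V :: "('a, 'm) cvec_scheme" (structure)
  assumes zero_closed: "\<zero> \<in> carrier V"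
    and add_closed: "\<lbrakk>x \<in> carrier V; y \<in> carrier V\<rbrakk> \<Longrightarrow> x \<oplus> y \<in> carrier V"
    and scale_closed: "x \<in> carrier V \<Longrightarrow> c \<odot> x \<in> carrier V"
    and add_assoc: "\<lbrakk>x \<in> carrier V; y \<in> carrier V; z \<in> carrier V\<rbrakk> \<Longrightarrow> (x \<oplus> y) \<oplus> z = x \<oplus> (y \<oplus> z)"
    and add_commute: "\<lbrakk>x \<in> carrier V; y \<in> carrier V\<rbrakk> \<Longrightarrow> x \<oplus> y = y \<oplus> x"
    and zero_add: "x \<in> carrier V \<Longrightarrow> \<zero> \<oplus> x = x"
    and minus_self: "x \<in> carrier V \<Longrightarrow> x \<ominus> x = \<zero>"
    and scale_add_right: "\<lbrakk>x \<in> carrier V; y \<in> carrier V\<rbrakk> \<Longrightarrow> c \<odot> (x \<oplus> y) = c \<odot> x \<oplus> c \<odot> y"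
    and scale_add_left: "x \<in> carrier V \<Longrightarrow> (c + d) \<odot> x = c \<odot> x \<oplus> d \<odot> x"
    and scale_scale: "x \<in> carrier V \<Longrightarrow> c \<odot> (d \<odot> x) = (c * d) \<odot> x"
    and scale_one: "x \<in> carrier V \<Longrightarrow> 1 \<odot> x = x"

record 'a cstar = "'a cvec" +
  mult :: "'a \<Rightarrow> 'a \<Rightarrow> 'a" (infixl "\<otimes>\<index>" 70)
  star :: "'a \<Rightarrow> 'a"
  anorm :: "'a \<Rightarrow> real"

text \<open>C*-algebras need not have a unit.\<close>

locale cstar_algebra = complex_vector_space A
  for A :: "('a, 'm) cstar_scheme" (structure) +
  assumes mult_closed: "\<lbrakk>x \<in> carrier A; y \<in> carrier A\<rbrakk> \<Longrightarrow> x \<otimes> y \<in> carrier A"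
    and mult_assoc: "\<lbrakk>x \<in> carrier A; y \<in> carrier A; z \<in> carrier A\<rbrakk> \<Longrightarrow> (x \<otimes> y) \<otimes> z = x \<otimes> (y \<otimes> z)"
    and mult_add_left: "\<lbrakk>x \<in> carrier A; y \<in> carrier A; z \<in> carrier A\<rbrakk>
          \<Longrightarrow> (x \<oplus> y) \<otimes> z = x \<otimes> z \<oplus> y \<otimes> z"
    and mult_add_right: "\<lbrakk>x \<in> carrier A; y \<in> carrier A; z \<in> carrier A\<rbrakk>
          \<Longrightarrow> x \<otimes> (y \<oplus> z) = x \<otimes> y \<oplus> x \<otimes> z"
    and mult_scale_left: "\<lbrakk>x \<in> carrier A; y \<in> carrier A\<rbrakk> \<Longrightarrow> (c \<odot> x) \<otimes> y = c \<odot> (x \<otimes> y)"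
    and mult_scale_right: "\<lbrakk>x \<in> carrier A; y \<in> carrier A\<rbrakk> \<Longrightarrow> x \<otimes> (c \<odot> y) = c \<odot> (x \<otimes> y)"
    and star_closed: "x \<in> carrier A \<Longrightarrow> star A x \<in> carrier A"
    and star_star: "x \<in> carrier A \<Longrightarrow> star A (star A x) = x"
    and star_add: "\<lbrakk>x \<in> carrier A; y \<in> carrier A\<rbrakk> \<Longrightarrow> star A (x \<oplus> y) = star A x \<oplus> star A y"
    and star_scale: "x \<in> carrier A \<Longrightarrow> star A (c \<odot> x) = cnj c \<odot> star A x"
    and star_mult: "\<lbrakk>x \<in> carrier A; y \<in> carrier A\<rbrakk> \<Longrightarrow> star A (x \<otimes> y) = star A y \<otimes> star A x"
    and norm_nonneg: "x \<in> carrier A \<Longrightarrow> 0 \<le> anorm A x"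
    and norm_eq_zero: "x \<in> carrier A \<Longrightarrow> anorm A x = 0 \<longleftrightarrow> x = \<zero>"
    and norm_triangle: "\<lbrakk>x \<in> carrier A; y \<in> carrier A\<rbrakk> \<Longrightarrow> anorm A (x \<oplus> y) \<le> anorm A x + anorm A y"
    and norm_scale: "x \<in> carrier A \<Longrightarrow> anorm A (c \<odot> x) = cmod c * anorm A x"
    and norm_mult: "\<lbrakk>x \<in> carrier A; y \<in> carrier A\<rbrakk> \<Longrightarrow> anorm A (x \<otimes> y) \<le> anorm A x * anorm A y"
    and cstar_identity: "x \<in> carrier A \<Longrightarrow> anorm A (star A x \<otimes> x) = (anorm A x)\<^sup>2"
    and complete: "\<lbrakk>\<And>n. X n \<in> carrier A;
           \<And>\<epsilon>. \<epsilon> > 0 \<Longrightarrow> \<exists>N::nat. \<forall>m\<ge>N. \<forall>n\<ge>N. anorm A (X m \<ominus> X n) < \<epsilon>\<rbrakk>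
          \<Longrightarrow> \<exists>l\<in>carrier A. (\<lambda>n. anorm A (X n \<ominus> l)) \<longlonglongrightarrow> 0"

definition cstar_le :: "('a, 'm) cstar_scheme \<Rightarrow> 'a \<Rightarrow> 'a \<Rightarrow> bool"
  where "cstar_le A a b \<longleftrightarrow> (\<exists>c\<in>carrier A. b \<ominus>\<^bsub>A\<^esub> a = star A c \<otimes>\<^bsub>A\<^esub> c)"

definition projection :: "('a, 'm) cstar_scheme \<Rightarrow> 'a \<Rightarrow> bool"
  where "projection A p \<longleftrightarrow> p \<in> carrier A \<and> star A p = p \<and> p \<otimes>\<^bsub>A\<^esub> p = p"

definition partial_isometry :: "('a, 'm) cstar_scheme \<Rightarrow> 'a \<Rightarrow> bool"
  where "partial_isometry A s \<longleftrightarrow> s \<in> carrier A \<and> s \<otimes>\<^bsub>A\<^esub> star A s \<otimes>\<^bsub>A\<^esub> s = s"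

definition star_hom :: "('a, 'm) cstar_scheme \<Rightarrow> ('b, 'n) cstar_scheme \<Rightarrow> ('a \<Rightarrow> 'b) \<Rightarrow> bool"
  where "star_hom A B \<phi> \<longleftrightarrow>
    (\<forall>a\<in>carrier A. \<phi> a \<in> carrier B) \<and>
    (\<forall>a\<in>carrier A. \<forall>b\<in>carrier A. \<phi> (a \<oplus>\<^bsub>A\<^esub> b) = \<phi> a \<oplus>\<^bsub>B\<^esub> \<phi> b) \<and>
    (\<forall>a\<in>carrier A. \<forall>c. \<phi> (c \<odot>\<^bsub>A\<^esub> a) = c \<odot>\<^bsub>B\<^esub> \<phi> a) \<and>
    (\<forall>a\<in>carrier A. \<forall>b\<in>carrier A. \<phi> (a \<otimes>\<^bsub>A\<^esub> b) = \<phi> a \<otimes>\<^bsub>B\<^esub> \<phi> b) \<and>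
    (\<forall>a\<in>carrier A. \<phi> (star A a) = star B (\<phi> a))"

inductive_set cstar_generated :: "('a, 'm) cstar_scheme \<Rightarrow> 'a set \<Rightarrow> 'a set"
  for A :: "('a, 'm) cstar_scheme" and G :: "'a set"
  where
    base: "x \<in> G \<Longrightarrow> x \<in> cstar_generated A G"
  | zero: "\<zero>\<^bsub>A\<^esub> \<in> cstar_generated A G"
  | add: "\<lbrakk>x \<in> cstar_generated A G; y \<in> cstar_generated A G\<rbrakk> \<Longrightarrow> x \<oplus>\<^bsub>A\<^esub> y \<in> cstar_generated A G"
  | scale: "x \<in> cstar_generated A G \<Longrightarrow> c \<odot>\<^bsub>A\<^esub> x \<in> cstar_generated A G"
  | mult: "\<lbrakk>x \<in> cstar_generated A G; y \<in> cstar_generated A G\<rbrakk> \<Longrightarrow> x \<otimes>\<^bsub>A\<^esub> y \<in> cstar_generated A G"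
  | star: "x \<in> cstar_generated A G \<Longrightarrow> star A x \<in> cstar_generated A G"
  | limit: "\<lbrakk>\<And>n. X n \<in> cstar_generated A G; l \<in> carrier A; (\<lambda>n::nat. anorm A (X n \<ominus>\<^bsub>A\<^esub> l)) \<longlonglongrightarrow> 0\<rbrakk>
      \<Longrightarrow> l \<in> cstar_generated A G"

record 'h hilb = "'h cvec" +
  hinner :: "'h \<Rightarrow> 'h \<Rightarrow> complex"

definition hnorm :: "('h, 'm) hilb_scheme \<Rightarrow> 'h \<Rightarrow> real"
  where "hnorm H x = sqrt (Re (hinner H x x))"

text \<open>The inner product is linear in the first argument.\<close>

locale hilbert_space = complex_vector_space H
  for H :: "('h, 'm) hilb_scheme" (structure) +
  assumes inner_commute: "\<lbrakk>x \<in> carrier H; y \<in> carrier H\<rbrakk> \<Longrightarrow> hinner H x y = cnj (hinner H y x)"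
    and inner_add_left: "\<lbrakk>x \<in> carrier H; y \<in> carrier H; z \<in> carrier H\<rbrakk>
          \<Longrightarrow> hinner H (x \<oplus> y) z = hinner H x z + hinner H y z"
    and inner_scale_left: "\<lbrakk>x \<in> carrier H; y \<in> carrier H\<rbrakk> \<Longrightarrow> hinner H (c \<odot> x) y = c * hinner H x y"
    and inner_nonneg: "x \<in> carrier H \<Longrightarrow> 0 \<le> Re (hinner H x x)"
    and inner_eq_zero: "\<lbrakk>x \<in> carrier H; hinner H x x = 0\<rbrakk> \<Longrightarrow> x = \<zero>"
    and complete: "\<lbrakk>\<And>n. X n \<in> carrier H;
           \<And>\<epsilon>. \<epsilon> > 0 \<Longrightarrow> \<exists>N::nat. \<forall>m\<ge>N. \<forall>n\<ge>N. hnorm H (X m \<ominus> X n) < \<epsilon>\<rbrakk>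
          \<Longrightarrow> \<exists>l\<in>carrier H. (\<lambda>n. hnorm H (X n \<ominus> l)) \<longlonglongrightarrow> 0"

definition hdense_in :: "('h, 'm) hilb_scheme \<Rightarrow> 'h set \<Rightarrow> 'h set \<Rightarrow> bool"
  where "hdense_in H D W \<longleftrightarrow>
    D \<subseteq> W \<and> (\<forall>x\<in>W. \<forall>\<epsilon>>0. \<exists>y\<in>D. hnorm H (x \<ominus>\<^bsub>H\<^esub> y) < \<epsilon>)"

definition separable :: "('h, 'm) hilb_scheme \<Rightarrow> bool"
  where "separable H \<longleftrightarrow> (\<exists>D. countable D \<and> hdense_in H D (carrier H))"

inductive_set cspan :: "('a, 'm) cvec_scheme \<Rightarrow> 'a set \<Rightarrow> 'a set"
  for V :: "('a, 'm) cvec_scheme" and B :: "'a set"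
  where
    base: "x \<in> B \<Longrightarrow> x \<in> cspan V B"
  | zero: "\<zero>\<^bsub>V\<^esub> \<in> cspan V B"
  | add: "\<lbrakk>x \<in> cspan V B; y \<in> cspan V B\<rbrakk> \<Longrightarrow> x \<oplus>\<^bsub>V\<^esub> y \<in> cspan V B"
  | scale: "x \<in> cspan V B \<Longrightarrow> c \<odot>\<^bsub>V\<^esub> x \<in> cspan V B"

definition orthonormal :: "('h, 'm) hilb_scheme \<Rightarrow> 'h set \<Rightarrow> bool"
  where "orthonormal H B \<longleftrightarrow> B \<subseteq> carrier H \<and>
    (\<forall>x\<in>B. \<forall>y\<in>B. hinner H x y = (if x = y then 1 else 0))"

text \<open>Here \<open>W\<close> is a closed linear subspace of \<open>H\<close>, possibly \<open>H\<close> itself.\<close>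

definition orthonormal_basis :: "('h, 'm) hilb_scheme \<Rightarrow> 'h set \<Rightarrow> 'h set \<Rightarrow> bool"
  where "orthonormal_basis H W B \<longleftrightarrow> orthonormal H B \<and> hdense_in H (cspan H B) W"

section \<open>Representations and unitary equivalence\<close>

definition linear_map :: "('a, 'm) cvec_scheme \<Rightarrow> ('b, 'n) cvec_scheme \<Rightarrow> ('a \<Rightarrow> 'b) \<Rightarrow> bool"
  where "linear_map V W T \<longleftrightarrow>
    (\<forall>x\<in>carrier V. T x \<in> carrier W) \<and>
    (\<forall>x\<in>carrier V. \<forall>y\<in>carrier V. T (x \<oplus>\<^bsub>V\<^esub> y) = T x \<oplus>\<^bsub>W\<^esub> T y) \<and>
    (\<forall>x\<in>carrier V. \<forall>c. T (c \<odot>\<^bsub>V\<^esub> x) = c \<odot>\<^bsub>W\<^esub> T x)"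

definition bounded_operator :: "('h, 'm) hilb_scheme \<Rightarrow> ('h \<Rightarrow> 'h) \<Rightarrow> bool"
  where "bounded_operator H T \<longleftrightarrow>
    linear_map H H T \<and> (\<exists>K. \<forall>x\<in>carrier H. hnorm H (T x) \<le> K * hnorm H x)"

definition is_adjoint :: "('h, 'm) hilb_scheme \<Rightarrow> ('h \<Rightarrow> 'h) \<Rightarrow> ('h \<Rightarrow> 'h) \<Rightarrow> bool"
  where "is_adjoint H T T' \<longleftrightarrow>
    (\<forall>x\<in>carrier H. \<forall>y\<in>carrier H. hinner H (T x) y = hinner H x (T' y))"

text \<open>
  A *-representation of \<open>A\<close> on \<open>H\<close>, that is, a *-homomorphism from \<open>A\<close> to \<open>B(H)\<close>, not required to be
  nondegenerate. Operators matter only on the carrier of \<open>H\<close>, so their equality is pointwise there.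
\<close>

definition star_representation ::
    "('a, 'm) cstar_scheme \<Rightarrow> ('h, 'n) hilb_scheme \<Rightarrow> ('a \<Rightarrow> 'h \<Rightarrow> 'h) \<Rightarrow> bool"
  where "star_representation A H \<pi> \<longleftrightarrow>
    (\<forall>a\<in>carrier A. bounded_operator H (\<pi> a)) \<and>
    (\<forall>a\<in>carrier A. \<forall>b\<in>carrier A. \<forall>x\<in>carrier H. \<pi> (a \<oplus>\<^bsub>A\<^esub> b) x = \<pi> a x \<oplus>\<^bsub>H\<^esub> \<pi> b x) \<and>
    (\<forall>a\<in>carrier A. \<forall>c. \<forall>x\<in>carrier H. \<pi> (c \<odot>\<^bsub>A\<^esub> a) x = c \<odot>\<^bsub>H\<^esub> \<pi> a x) \<and>
    (\<forall>a\<in>carrier A. \<forall>b\<in>carrier A. \<forall>x\<in>carrier H. \<pi> (a \<otimes>\<^bsub>A\<^esub> b) x = \<pi> a (\<pi> b x)) \<and>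
    (\<forall>a\<in>carrier A. is_adjoint H (\<pi> a) (\<pi> (star A a)))"

definition unitary :: "('h, 'm) hilb_scheme \<Rightarrow> ('k, 'n) hilb_scheme \<Rightarrow> ('h \<Rightarrow> 'k) \<Rightarrow> bool"
  where "unitary H K U \<longleftrightarrow>
    linear_map H K U \<and> bij_betw U (carrier H) (carrier K) \<and>
    (\<forall>x\<in>carrier H. \<forall>y\<in>carrier H. hinner K (U x) (U y) = hinner H x y)"

definition unitarily_equivalent ::
    "('a, 'm) cstar_scheme \<Rightarrow> ('h, 'n) hilb_scheme \<Rightarrow> ('a \<Rightarrow> 'h \<Rightarrow> 'h)
      \<Rightarrow> ('k, 'p) hilb_scheme \<Rightarrow> ('a \<Rightarrow> 'k \<Rightarrow> 'k) \<Rightarrow> bool"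
  where "unitarily_equivalent A H \<pi> K \<rho> \<longleftrightarrow>
    (\<exists>U. unitary H K U \<and> (\<forall>a\<in>carrier A. \<forall>x\<in>carrier H. U (\<pi> a x) = \<rho> a (U x)))"

section \<open>Graph C*-algebras\<close>

definition cuntz_krieger_family ::
    "('v, 'e) pre_digraph \<Rightarrow> ('a, 'm) cstar_scheme \<Rightarrow> ('v \<Rightarrow> 'a) \<Rightarrow> ('e \<Rightarrow> 'a) \<Rightarrow> bool"
  where "cuntz_krieger_family E A P S \<longleftrightarrow>
    (\<forall>v\<in>verts E. projection A (P v)) \<and>
    (\<forall>e\<in>arcs E. partial_isometry A (S e)) \<and>
    (\<forall>e\<in>arcs E. \<forall>d\<in>arcs E. e \<noteq> d \<longrightarrow>
      (S e \<otimes>\<^bsub>A\<^esub> star A (S e)) \<otimes>\<^bsub>A\<^esub> (S d \<otimes>\<^bsub>A\<^esub> star A (S d)) = \<zero>\<^bsub>A\<^esub>) \<and>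
    (\<forall>u\<in>verts E. \<forall>v\<in>verts E. u \<noteq> v \<longrightarrow> P u \<otimes>\<^bsub>A\<^esub> P v = \<zero>\<^bsub>A\<^esub>) \<and>
    (\<forall>e\<in>arcs E. star A (S e) \<otimes>\<^bsub>A\<^esub> S e = P (head E e)) \<and>
    (\<forall>e\<in>arcs E. cstar_le A (S e \<otimes>\<^bsub>A\<^esub> star A (S e)) (P (tail E e))) \<and>
    (\<forall>v\<in>verts E. finite (out_arcs E v) \<and> out_arcs E v \<noteq> {} \<longrightarrow>
      P v = vsum A (\<lambda>e. S e \<otimes>\<^bsub>A\<^esub> star A (S e)) (out_arcs E v))"

text \<open>
  \<open>(A, P, S)\<close> is the universal C*-algebra \<open>C\<^sup>*(E)\<close> of a countable graph \<open>E\<close>. The competitors \<open>B\<close> range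
  over the C*-algebras whose underlying set is a set of reals (the algebra operations of \<open>B\<close> are
  arbitrary, they have nothing to do with the arithmetic of \<^typ>\<open>real\<close>), since one cannot quantify over
  types. This is no restriction: a family indexed by a countable graph generates a separable
  C*-algebra, which has at most continuum many elements and hence an isomorphic copy of that form.
  Uniqueness of \<open>\<phi>\<close> follows from generation.
\<close>

definition graph_cstar_algebra ::
    "('v, 'e) pre_digraph \<Rightarrow> 'a cstar \<Rightarrow> ('v \<Rightarrow> 'a) \<Rightarrow> ('e \<Rightarrow> 'a) \<Rightarrow> bool"
  where "graph_cstar_algebra E A P S \<longleftrightarrow>
    cstar_algebra A \<and>
    cuntz_krieger_family E A P S \<and>
    cstar_generated A (P ` verts E \<union> S ` arcs E) = carrier A \<and>
    (\<forall>(B :: real cstar) Q T. cstar_algebra B \<and> cuntz_krieger_family E B Q T \<longrightarrow>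
      (\<exists>\<phi>. star_hom A B \<phi> \<and> (\<forall>v\<in>verts E. \<phi> (P v) = Q v) \<and> (\<forall>e\<in>arcs E. \<phi> (S e) = T e)))"

section \<open>The Hilbert space of square-integrable functions\<close>

definition square_integrable :: "'x measure \<Rightarrow> ('x \<Rightarrow> complex) set"
  where "square_integrable M =
    {\<phi> \<in> borel_measurable M. integrable M (\<lambda>x. (cmod (\<phi> x))\<^sup>2)}"

definition l2_class :: "'x measure \<Rightarrow> ('x \<Rightarrow> complex) \<Rightarrow> ('x \<Rightarrow> complex) set"
  where "l2_class M \<phi> = {\<psi> \<in> borel_measurable M. AE x in M. \<psi> x = \<phi> x}"

definition l2_rep :: "('x \<Rightarrow> complex) set \<Rightarrow> 'x \<Rightarrow> complex"
  where "l2_rep F = (SOME \<phi>. \<phi> \<in> F)"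

definition L2 :: "'x measure \<Rightarrow> ('x \<Rightarrow> complex) set hilb"
  where "L2 M = \<lparr>
    carrier = l2_class M ` square_integrable M,
    vzero = l2_class M (\<lambda>_. 0),
    vadd = (\<lambda>F G. l2_class M (\<lambda>x. l2_rep F x + l2_rep G x)),
    vscale = (\<lambda>c F. l2_class M (\<lambda>x. c * l2_rep F x)),
    hinner = (\<lambda>F G. \<integral>x. l2_rep F x * cnj (l2_rep G x) \<partial>M)\<rparr>"

section \<open>Branching systems and the induced representations\<close>

definition ae_subset :: "'x measure \<Rightarrow> 'x set \<Rightarrow> 'x set \<Rightarrow> bool"
  where "ae_subset M B A \<longleftrightarrow> B - A \<in> null_sets M"

definition ae_eq_set :: "'x measure \<Rightarrow> 'x set \<Rightarrow> 'x set \<Rightarrow> bool"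
  where "ae_eq_set M A B \<longleftrightarrow> ae_subset M A B \<and> ae_subset M B A"

definition ae_eq_map :: "'x measure \<Rightarrow> 'x set \<Rightarrow> ('x \<Rightarrow> 'y) \<Rightarrow> ('x \<Rightarrow> 'y) \<Rightarrow> bool"
  where "ae_eq_map M D f g \<longleftrightarrow> {x \<in> D. f x \<noteq> g x} \<in> null_sets M"

text \<open>
  \<open>\<Phi>\<close> is a Radon-Nikodym derivative of the set function \<open>\<mu> \<circ> f\<close>, \<open>A \<mapsto> \<mu>(f(A))\<close>, with respect to \<open>\<mu>\<close>
  in \<open>D\<close>. For \<open>\<mu> \<circ> f\<close> to make sense the sets \<open>f(A)\<close> must be measurable. The library constant
  \<^const>\<open>RN_deriv\<close> is not used since it is total, so it does not express that a derivative exists.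
\<close>

definition is_RN_derivative ::
    "'x measure \<Rightarrow> 'x set \<Rightarrow> ('x \<Rightarrow> 'x) \<Rightarrow> ('x \<Rightarrow> real) \<Rightarrow> bool"
  where "is_RN_derivative M D f \<Phi> \<longleftrightarrow>
    \<Phi> \<in> borel_measurable (restrict_space M D) \<and> (\<forall>x\<in>D. 0 \<le> \<Phi> x) \<and>
    (\<forall>A \<in> sets (restrict_space M D).
      f ` A \<in> sets M \<and> emeasure M (f ` A) = emeasure (density (restrict_space M D) (\<lambda>x. ennreal (\<Phi> x))) A)"

text \<open>
  \<open>f e\<close> and \<open>g e\<close> stand for \<open>f\<^sub>e\<close> and \<open>f\<^sub>e\<close> inverse, \<open>\<Phi> e\<close> and \<open>\<Psi> e\<close> for their Radon-Nikodym derivatives.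
\<close>

locale branching_system = wf_digraph E
  for E :: "('v, 'e) pre_digraph" +
  fixes M :: "'x measure"
    and R :: "'e \<Rightarrow> 'x set" and D :: "'v \<Rightarrow> 'x set"
    and f g :: "'e \<Rightarrow> 'x \<Rightarrow> 'x"
    and \<Phi> \<Psi> :: "'e \<Rightarrow> 'x \<Rightarrow> real"
  assumes R_sets: "e \<in> arcs E \<Longrightarrow> R e \<in> sets M"
    and D_sets: "v \<in> verts E \<Longrightarrow> D v \<in> sets M"
    and R_disjoint: "\<lbrakk>e \<in> arcs E; d \<in> arcs E; d \<noteq> e\<rbrakk> \<Longrightarrow> ae_eq_set M (R e \<inter> R d) {}"
    and D_disjoint: "\<lbrakk>u \<in> verts E; v \<in> verts E; u \<noteq> v\<rbrakk> \<Longrightarrow> ae_eq_set M (D u \<inter> D v) {}"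
    and R_subset: "e \<in> arcs E \<Longrightarrow> ae_subset M (R e) (D (tail E e))"
    and D_union: "\<lbrakk>v \<in> verts E; finite (out_arcs E v); out_arcs E v \<noteq> {}\<rbrakk>
          \<Longrightarrow> ae_eq_set M (D v) (\<Union>e\<in>out_arcs E v. R e)"
    and f_map: "e \<in> arcs E \<Longrightarrow> f e \<in> D (head E e) \<rightarrow> R e"
    and f_onto: "e \<in> arcs E \<Longrightarrow> ae_eq_set M (f e ` D (head E e)) (R e)"
    and f_derivative: "e \<in> arcs E \<Longrightarrow> is_RN_derivative M (D (head E e)) (f e) (\<Phi> e)"
    and f_derivative_pos: "e \<in> arcs E \<Longrightarrow> AE x in M. x \<in> D (head E e) \<longrightarrow> \<Phi> e x > 0"
    and g_map: "e \<in> arcs E \<Longrightarrow> g e \<in> R e \<rightarrow> D (head E e)"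
    and f_g: "e \<in> arcs E \<Longrightarrow> ae_eq_map M (R e) (f e \<circ> g e) id"
    and g_f: "e \<in> arcs E \<Longrightarrow> ae_eq_map M (D (head E e)) (g e \<circ> f e) id"
    and g_derivative: "e \<in> arcs E \<Longrightarrow> is_RN_derivative M (R e) (g e) (\<Psi> e)"

text \<open>
  As \<open>C\<^sup>*(E)\<close> is generated by the \<open>P v\<close> and \<open>S e\<close>, these formulas determine \<open>\<pi>\<close>. They are required for
  every representative \<open>\<phi>\<close> of an element of \<open>L\<^sup>2\<close>.
\<close>

definition induced_representation ::
    "('v, 'e) pre_digraph \<Rightarrow> 'a cstar \<Rightarrow> ('v \<Rightarrow> 'a) \<Rightarrow> ('e \<Rightarrow> 'a) \<Rightarrow>
     'x measure \<Rightarrow> ('e \<Rightarrow> 'x set) \<Rightarrow> ('v \<Rightarrow> 'x set) \<Rightarrow> ('e \<Rightarrow> 'x \<Rightarrow> 'x) \<Rightarrow> ('e \<Rightarrow> 'x \<Rightarrow> real) \<Rightarrow>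
     ('a \<Rightarrow> ('x \<Rightarrow> complex) set \<Rightarrow> ('x \<Rightarrow> complex) set) \<Rightarrow> bool"
  where "induced_representation E A P S M R D g \<Psi> \<pi> \<longleftrightarrow>
    star_representation A (L2 M) \<pi> \<and>
    (\<forall>e\<in>arcs E. \<forall>\<phi>\<in>square_integrable M.
      \<pi> (S e) (l2_class M \<phi>) =
        l2_class M (\<lambda>x. indicator (R e) x * complex_of_real (sqrt (\<Psi> e x)) * \<phi> (g e x))) \<and>
    (\<forall>v\<in>verts E. \<forall>\<phi>\<in>square_integrable M.
      \<pi> (P v) (l2_class M \<phi>) = l2_class M (\<lambda>x. indicator (D v) x * \<phi> x))"

end

theory Submission
  imports Defs
begin

text \<open>
  Expanding vectors of \<open>H\<close> in the basis \<open>h\<close> is a unitary \<open>U\<close> from \<open>H\<close> onto \<open>\<ell>\<^sup>2(\<nat>)\<close>, so every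
  representation on \<open>H\<close> has an equivalent copy \<open>\<rho> a = U \<circ> \<pi> a \<circ> U\<inverse>\<close> on \<open>\<ell>\<^sup>2(\<nat>)\<close>
  (\<open>star_representation_transport\<close>). What has to be seen is that \<open>\<rho>\<close> comes from a branching
  system, and the reason is that in the basis \<open>h\<close> the generators are matrices with entries 0 and 1.

  The orthonormal bases of the ranges of the \<open>\<pi> (P v)\<close> and \<open>\<pi> (S e)\<close> consist of vectors \<open>h n\<close>, so
  they may be replaced by the sets \<open>D v\<close> and \<open>R e\<close> of their indices. A projection that has part of
  \<open>h\<close> as a basis of its range fixes that part and annihilates the rest of \<open>h\<close>
  (\<open>rep_projection_fixes_basis\<close>, \<open>rep_projection_kills_orthogonal\<close>): so \<open>\<rho> (P v)\<close> is
  multiplication by the indicator of \<open>D v\<close>, and mutually orthogonal projections have disjoint index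
  sets. By hypothesis \<open>\<pi> (S e)\<close> maps the basis of \<open>H\<^bsub>r(e)\<^esub>\<close> onto that of \<open>H\<^bsub>e\<^esub>\<close>; it is injective
  there since \<open>\<pi> (S e)\<close> has the left inverse \<open>\<pi> (S e)\<^sup>*\<close> on \<open>H\<^bsub>r(e)\<^esub>\<close>. On indices this is a bijection \<open>f e\<close> from
  \<open>D (r e)\<close> to \<open>R e\<close>. A bijection preserves counting measure, so all Radon-Nikodym derivatives
  are 1. Finally the \<open>n\<close>-th coefficient of \<open>\<pi> (S e) x\<close> is the inner product of \<open>x\<close> with
  \<open>\<pi> (S e)\<^sup>* (h n)\<close>, and this vector is \<open>h\<close> at \<open>f e\<inverse> n\<close> for \<open>n \<in> R e\<close> and zero
  otherwise, which is the formula for the induced representation.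
\<close>

section \<open>Inner products\<close>

context complex_vector_space
begin

lemma minus_closed: "\<lbrakk>x \<in> carrier V; y \<in> carrier V\<rbrakk> \<Longrightarrow> x \<ominus> y \<in> carrier V"
  by (simp add: vminus_def add_closed scale_closed)

lemma scale_zero_left: assumes "x \<in> carrier V" shows "0 \<odot> x = \<zero>"
  using scale_add_left[OF assms, of 1 "-1"] minus_self[OF assms] scale_one[OF assms]
  by (simp add: vminus_def)

lemma eq_if_minus_eq_zero:
  assumes x: "x \<in> carrier V" and y: "y \<in> carrier V" and "x \<ominus> y = \<zero>"
  shows "x = y"
proof -
  have ny: "(-1) \<odot> y \<in> carrier V" using y by (rule scale_closed)
  have cancel: "(-1) \<odot> y \<oplus> y = \<zero>"
    using minus_self[OF y] add_commute[OF ny y] by (simp add: vminus_def)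
  have "x = x \<oplus> \<zero>" using add_commute[OF x zero_closed] zero_add[OF x] by simp
  also have "\<dots> = (x \<ominus> y) \<oplus> y" using add_assoc[OF x ny y] cancel by (simp add: vminus_def)
  also have "\<dots> = y" using assms(3) zero_add[OF y] by simp
  finally show ?thesis .
qed

end

context hilbert_space
begin

lemma inner_add_right:
  assumes "x \<in> carrier H" "y \<in> carrier H" "z \<in> carrier H"
  shows "hinner H x (y \<oplus> z) = hinner H x y + hinner H x z"
proof -
  have "hinner H x (y \<oplus> z) = cnj (hinner H (y \<oplus> z) x)"
    using assms by (intro inner_commute add_closed)
  also have "\<dots> = cnj (hinner H y x) + cnj (hinner H z x)"
    using assms by (simp add: inner_add_left)
  also have "\<dots> = hinner H x y + hinner H x z"
    by (simp only: inner_commute[OF assms(1,2), symmetric] inner_commute[OF assms(1,3), symmetric])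
  finally show ?thesis .
qed

lemma inner_scale_right:
  assumes "x \<in> carrier H" "y \<in> carrier H"
  shows "hinner H x (c \<odot> y) = cnj c * hinner H x y"
proof -
  have "hinner H x (c \<odot> y) = cnj (hinner H (c \<odot> y) x)"
    using assms by (intro inner_commute scale_closed)
  also have "\<dots> = cnj c * cnj (hinner H y x)"
    using assms by (simp add: inner_scale_left)
  also have "\<dots> = cnj c * hinner H x y"
    by (simp only: inner_commute[OF assms, symmetric])
  finally show ?thesis .
qed

lemma inner_minus_left:
  "\<lbrakk>x \<in> carrier H; y \<in> carrier H; z \<in> carrier H\<rbrakk>
    \<Longrightarrow> hinner H (x \<ominus> y) z = hinner H x z - hinner H y z"
  by (simp add: vminus_def inner_add_left inner_scale_left scale_closed)

lemma inner_minus_right: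
  "\<lbrakk>x \<in> carrier H; y \<in> carrier H; z \<in> carrier H\<rbrakk>
    \<Longrightarrow> hinner H x (y \<ominus> z) = hinner H x y - hinner H x z"
  by (simp add: vminus_def inner_add_right inner_scale_right scale_closed)

lemma inner_zero_left: "x \<in> carrier H \<Longrightarrow> hinner H \<zero> x = 0"
  using inner_scale_left[of x x 0] scale_zero_left[of x] by simp

lemma inner_zero_right: "x \<in> carrier H \<Longrightarrow> hinner H x \<zero> = 0"
  using inner_zero_left inner_commute[of x \<zero>] zero_closed by simp

lemma hnorm_nonneg: "x \<in> carrier H \<Longrightarrow> 0 \<le> hnorm H x"
  by (simp add: hnorm_def inner_nonneg)

lemma inner_self: assumes "x \<in> carrier H" shows "hinner H x x = complex_of_real ((hnorm H x)\<^sup>2)"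
proof -
  have "Im (hinner H x x) = 0"
    using arg_cong[OF inner_commute[OF assms assms], of Im] by simp
  then show ?thesis
    using inner_nonneg[OF assms] by (simp add: hnorm_def complex_eq_iff)
qed

lemma hnorm_eq_zero: "\<lbrakk>x \<in> carrier H; hnorm H x = 0\<rbrakk> \<Longrightarrow> x = \<zero>"
  using inner_self inner_eq_zero by simp

lemma Cauchy_Schwarz:
  assumes x: "x \<in> carrier H" and y: "y \<in> carrier H"
  shows "cmod (hinner H x y) \<le> hnorm H x * hnorm H y"
proof (cases "hnorm H y = 0")
  case True
  then have "y = \<zero>" using y by (rule hnorm_eq_zero[rotated])
  then show ?thesis using True x by (simp add: inner_zero_right)
next
  case False
  then have pos: "hnorm H y > 0" using hnorm_nonneg[OF y] by simp
  define c where "c = hinner H x y / hinner H y y"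
  \<comment> \<open>The component of \<open>x\<close> orthogonal to \<open>y\<close>.\<close>
  define w where "w = x \<ominus> c \<odot> y"
  have cy: "c \<odot> y \<in> carrier H" using y by (rule scale_closed)
  have w: "w \<in> carrier H" unfolding w_def using x cy by (rule minus_closed)
  have wy: "hinner H w y = 0"
    using False x y cy inner_self[OF y]
    by (simp add: w_def c_def inner_minus_left inner_scale_left)
  have "hinner H w w = hinner H w x - cnj c * hinner H w y"
    using w x y cy by (subst (2) w_def) (simp add: inner_minus_right inner_scale_right)
  also have "\<dots> = hinner H x x - c * cnj (hinner H x y)"
    using wy x y cy inner_commute[OF y x] by (simp add: w_def inner_minus_left inner_scale_left)
  also have "c * cnj (hinner H x y) = complex_of_real ((cmod (hinner H x y))\<^sup>2 / (hnorm H y)\<^sup>2)"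
    by (simp add: c_def inner_self[OF y] complex_norm_square[symmetric] del: of_real_power)
  finally have "hinner H w w
      = complex_of_real ((hnorm H x)\<^sup>2 - (cmod (hinner H x y))\<^sup>2 / (hnorm H y)\<^sup>2)"
    by (simp add: inner_self[OF x])
  then have "0 \<le> (hnorm H x)\<^sup>2 - (cmod (hinner H x y))\<^sup>2 / (hnorm H y)\<^sup>2"
    using inner_nonneg[OF w] by (simp del: of_real_diff of_real_divide of_real_power)
  then have "(cmod (hinner H x y))\<^sup>2 \<le> (hnorm H x * hnorm H y)\<^sup>2"
    using pos by (simp add: field_simps)
  then show ?thesis
    by (rule power2_le_imp_le) (simp add: hnorm_nonneg x y)
qed

lemma hnorm_minus_commute:
  assumes x: "x \<in> carrier H" and y: "y \<in> carrier H"
  shows "hnorm H (x \<ominus> y) = hnorm H (y \<ominus> x)"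
  using assms by (simp add: hnorm_def inner_minus_left inner_minus_right minus_closed)

lemma inner_tendsto_if_hnorm_tendsto:
  assumes X: "\<And>n. X n \<in> carrier H" and x: "x \<in> carrier H" and y: "y \<in> carrier H"
    and lim: "(\<lambda>n. hnorm H (X n \<ominus> x)) \<longlonglongrightarrow> 0"
  shows "(\<lambda>n. hinner H (X n) y) \<longlonglongrightarrow> hinner H x y"
proof -
  have "(\<lambda>n. hnorm H (X n \<ominus> x) * hnorm H y) \<longlonglongrightarrow> 0"
    using tendsto_mult_right[OF lim, of "hnorm H y"] by simp
  then have "(\<lambda>n. hinner H (X n) y - hinner H x y) \<longlonglongrightarrow> 0"
  proof (rule Lim_null_comparison[rotated], intro always_eventually allI)
    fix n show "cmod (hinner H (X n) y - hinner H x y) \<le> hnorm H (X n \<ominus> x) * hnorm H y"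
      using Cauchy_Schwarz[OF minus_closed[OF X x] y] X x y by (simp add: inner_minus_left)
  qed
  then show ?thesis by (simp add: LIM_zero_iff)
qed

lemma cspan_carrier: assumes "B \<subseteq> carrier H" "y \<in> cspan H B" shows "y \<in> carrier H"
  using assms(2) by induction (use assms(1) zero_closed add_closed scale_closed in auto)

lemma orthogonal_cspan:
  assumes x: "x \<in> carrier H" and B: "B \<subseteq> carrier H" and orth: "\<And>b. b \<in> B \<Longrightarrow> hinner H x b = 0"
    and y: "y \<in> cspan H B"
  shows "hinner H x y = 0"
  using y
proof induction
  case (add y z)
  then show ?case using x cspan_carrier[OF B] by (simp add: inner_add_right)
next
  case (scale y c)
  then show ?case using x cspan_carrier[OF B] by (simp add: inner_scale_right)
qed (use x orth in \<open>auto simp: inner_zero_right\<close>)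

text \<open>
  The span of \<open>B\<close> is only dense in \<open>W\<close>; by Cauchy-Schwarz, orthogonality passes to limits.
\<close>

lemma orthogonal_basis_imp_orthogonal:
  assumes x: "x \<in> carrier H" and W: "W \<subseteq> carrier H" and B: "orthonormal_basis H W B"
    and orth: "\<And>b. b \<in> B \<Longrightarrow> hinner H x b = 0" and w: "w \<in> W"
  shows "hinner H x w = 0"
proof (rule ccontr)
  assume ne: "hinner H x w \<noteq> 0"
  have B_carrier: "B \<subseteq> carrier H" using B by (auto simp: orthonormal_basis_def orthonormal_def)
  have wc: "w \<in> carrier H" using w W by auto
  let ?\<epsilon> = "cmod (hinner H x w) / (hnorm H x + 1)"
  have "?\<epsilon> > 0" using ne hnorm_nonneg[OF x] by (simp add: add_nonneg_pos)
  then obtain y where y: "y \<in> cspan H B" and close: "hnorm H (w \<ominus> y) < ?\<epsilon>"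
    using B w unfolding orthonormal_basis_def hdense_in_def by blast
  have yc: "y \<in> carrier H" using cspan_carrier[OF B_carrier y] .
  have "hinner H x w = hinner H x (w \<ominus> y)"
    using x wc yc orthogonal_cspan[OF x B_carrier orth y] by (simp add: inner_minus_right)
  then have "cmod (hinner H x w) \<le> hnorm H x * hnorm H (w \<ominus> y)"
    using Cauchy_Schwarz[OF x minus_closed[OF wc yc]] by simp
  also have "\<dots> \<le> hnorm H x * ?\<epsilon>"
    using close hnorm_nonneg[OF x] by (intro mult_left_mono) auto
  also have "\<dots> < cmod (hinner H x w)"
    using ne hnorm_nonneg[OF x] by (simp add: field_simps)
  finally show False by simp
qed

end

section \<open>Expansion in an orthonormal basis\<close>

primrec partial_sum :: "('h, 'm) hilb_scheme \<Rightarrow> (nat \<Rightarrow> 'h) \<Rightarrow> (nat \<Rightarrow> complex) \<Rightarrow> nat \<Rightarrow> 'h"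
  where
    "partial_sum H h c 0 = \<zero>\<^bsub>H\<^esub>"
  | "partial_sum H h c (Suc n) = partial_sum H h c n \<oplus>\<^bsub>H\<^esub> c n \<odot>\<^bsub>H\<^esub> h n"

locale orthonormal_basis_sequence = hilbert_space H
  for H :: "('h, 'm) hilb_scheme" (structure) +
  fixes h :: "nat \<Rightarrow> 'h"
  assumes inj_h: "inj h"
    and basis: "orthonormal_basis H (carrier H) (range h)"
begin

lemma h_carrier: "h n \<in> carrier H"
  using basis by (auto simp: orthonormal_basis_def orthonormal_def)

lemma inner_h_h: "hinner H (h i) (h j) = (if i = j then 1 else 0)"
  using basis inj_h by (auto simp: orthonormal_basis_def orthonormal_def inj_eq)

abbreviation coeff :: "'h \<Rightarrow> nat \<Rightarrow> complex"
  where "coeff x \<equiv> (\<lambda>n. hinner H x (h n))"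

abbreviation psum :: "(nat \<Rightarrow> complex) \<Rightarrow> nat \<Rightarrow> 'h"
  where "psum \<equiv> partial_sum H h"

lemma partial_sum_closed: "psum c n \<in> carrier H"
  by (induction n) (simp_all add: zero_closed add_closed scale_closed h_carrier)

lemma inner_partial_sum:
  "y \<in> carrier H \<Longrightarrow> hinner H (psum c n) y = (\<Sum>k<n. c k * hinner H (h k) y)"
  by (induction n)
    (simp_all add: inner_zero_left inner_add_left inner_scale_left partial_sum_closed
      scale_closed h_carrier)

lemma inner_partial_sum_basis: "hinner H (psum c n) (h j) = (if j < n then c j else 0)"
  by (simp add: inner_partial_sum h_carrier inner_h_h if_distrib sum.delta' cong: if_cong)

lemma inner_partial_sums:
  assumes "m \<le> n"
  shows "hinner H (psum c m) (psum c n) = complex_of_real (\<Sum>k<m. (cmod (c k))\<^sup>2)"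
proof -
  have "hinner H (h k) (psum c n) = cnj (c k)" if "k < m" for k
    using that assms inner_commute[OF h_carrier partial_sum_closed]
    by (simp add: inner_partial_sum_basis)
  then show ?thesis
    by (simp add: inner_partial_sum partial_sum_closed complex_norm_square del: of_real_power)
qed

text \<open>
  Every vector in the span of \<open>h\<close> involves only finitely many \<open>h k\<close>. In this form no finite
  linear combination has to be written down.
\<close>

lemma orthogonal_to_span_if_orthogonal_to_initial:
  assumes "y \<in> cspan H (range h)"
  shows "\<exists>N. \<forall>z\<in>carrier H. (\<forall>k<N. hinner H z (h k) = 0) \<longrightarrow> hinner H z y = 0"
  using assms
proof induction
  case (base x)
  then obtain i where "x = h i" by auto
  then show ?case by (intro exI[of _ "Suc i"]) simp
next
  case zero
  then show ?case by (simp add: inner_zero_right)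
next
  case (add x y)
  then obtain M N
    where "\<forall>z\<in>carrier H. (\<forall>k<M. hinner H z (h k) = 0) \<longrightarrow> hinner H z x = 0"
      and "\<forall>z\<in>carrier H. (\<forall>k<N. hinner H z (h k) = 0) \<longrightarrow> hinner H z y = 0" by auto
  moreover have "x \<in> carrier H" "y \<in> carrier H"
    using add.hyps cspan_carrier[of "range h"] h_carrier by blast+
  ultimately show ?case
    by (intro exI[of _ "max M N"]) (auto simp: inner_add_right)
next
  case (scale x c)
  moreover have "x \<in> carrier H"
    using scale.hyps cspan_carrier[of "range h"] h_carrier by blast
  ultimately show ?case by (auto simp: inner_scale_right)
qed

text \<open>
  The remainder \<open>z\<close> after \<open>n\<close> terms is orthogonal to the partial sum and, for large \<open>n\<close>, to any
  given vector \<open>y\<close> of the span. Hence \<open>\<parallel>z\<parallel>\<^sup>2 = \<langle>z, x - y\<rangle>\<close>, and Cauchy-Schwarz shows that the partial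
  sum approximates \<open>x\<close> at least as well as \<open>y\<close> does.
\<close>

lemma partial_sum_converges:
  assumes x: "x \<in> carrier H"
  shows "(\<lambda>n. hnorm H (x \<ominus> psum (coeff x) n)) \<longlonglongrightarrow> 0"
proof (rule LIMSEQ_I)
  fix \<epsilon> :: real assume "\<epsilon> > 0"
  then obtain y where y: "y \<in> cspan H (range h)" and close: "hnorm H (x \<ominus> y) < \<epsilon>"
    using basis x unfolding orthonormal_basis_def hdense_in_def by blast
  have yc: "y \<in> carrier H" using y cspan_carrier[of "range h"] h_carrier by blast
  obtain N where N: "\<And>z. z \<in> carrier H \<Longrightarrow> (\<And>k. k < N \<Longrightarrow> hinner H z (h k) = 0) \<Longrightarrow> hinner H z y = 0"
    using orthogonal_to_span_if_orthogonal_to_initial[OF y] by blast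
  have "hnorm H (x \<ominus> psum (coeff x) n) < \<epsilon>" if "n \<ge> N" for n
  proof -
    define p where "p = psum (coeff x) n"
    define z where "z = x \<ominus> p"
    have p: "p \<in> carrier H" unfolding p_def by (rule partial_sum_closed)
    have z: "z \<in> carrier H" unfolding z_def using x p by (rule minus_closed)
    have zh: "hinner H z (h k) = 0" if "k < n" for k
      using that x p by (simp add: z_def inner_minus_left h_carrier) (simp add: p_def inner_partial_sum_basis)
    have "hinner H (h k) z = 0" if "k < n" for k
      using zh[OF that] inner_commute[OF h_carrier z] by simp
    then have "hinner H p z = 0"
      using z by (simp add: p_def inner_partial_sum)
    then have zp: "hinner H z p = 0" using inner_commute[OF z p] by simp
    have "hinner H z y = 0" using N[OF z] zh that by simp
    then have "hinner H z z = hinner H z (x \<ominus> y)"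
      using zp z x p yc by (subst (2) z_def) (simp add: inner_minus_right)
    then have "(hnorm H z)\<^sup>2 \<le> hnorm H z * hnorm H (x \<ominus> y)"
      using Cauchy_Schwarz[OF z minus_closed[OF x yc]] inner_self[OF z]
      by (metis norm_of_real abs_of_nonneg zero_le_power2)
    then have "hnorm H z \<le> hnorm H (x \<ominus> y)"
      using hnorm_nonneg[OF z] hnorm_nonneg[OF minus_closed[OF x yc]]
      by (cases "hnorm H z = 0") (auto simp: power2_eq_square)
    then show ?thesis using close by (simp add: z_def p_def)
  qed
  then show "\<exists>N. \<forall>n\<ge>N. norm (hnorm H (x \<ominus> psum (coeff x) n) - 0) < \<epsilon>"
    using hnorm_nonneg minus_closed[OF x partial_sum_closed] by auto
qed

lemma Parseval:
  assumes x: "x \<in> carrier H" and y: "y \<in> carrier H"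
  shows "(\<lambda>n. coeff x n * cnj (coeff y n)) sums hinner H x y"
proof -
  have "(\<lambda>n. hinner H (psum (coeff x) n) y) \<longlonglongrightarrow> hinner H x y"
    using partial_sum_converges[OF x] x y partial_sum_closed
    by (intro inner_tendsto_if_hnorm_tendsto) (simp_all add: hnorm_minus_commute)
  moreover have "hinner H (psum (coeff x) n) y = (\<Sum>k<n. coeff x k * cnj (coeff y k))" for n
    using y inner_commute[OF h_carrier y] by (simp add: inner_partial_sum)
  ultimately show ?thesis by (simp add: sums_def)
qed

lemma coeff_square_summable:
  assumes "x \<in> carrier H" shows "summable (\<lambda>n. (cmod (coeff x n))\<^sup>2)"
proof -
  have "summable (\<lambda>n. complex_of_real ((cmod (coeff x n))\<^sup>2))"
    using sums_summable[OF Parseval[OF assms assms]] by (simp only: complex_norm_square)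
  then show ?thesis by (simp only: summable_complex_of_real)
qed

text \<open>
  Riesz-Fischer: orthogonality turns the squared distance of two partial sums into a difference of
  partial sums of \<open>\<Sum>\<bar>c k\<bar>\<^sup>2\<close>, so they form a Cauchy sequence.
\<close>

lemma exists_vector_with_coefficients:
  assumes c: "summable (\<lambda>n. (cmod (c n))\<^sup>2)"
  shows "\<exists>x\<in>carrier H. coeff x = c"
proof -
  define s where "s n = (\<Sum>k<n. (cmod (c k))\<^sup>2)" for n
  have dist: "(hnorm H (psum c m \<ominus> psum c n))\<^sup>2 = s n - s m" if "m \<le> n" for m n
  proof -
    have "hinner H (psum c n) (psum c m) = complex_of_real (s m)"
      using inner_partial_sums[OF that] inner_commute[OF partial_sum_closed, of "psum c m" c n]
      by (simp add: s_def partial_sum_closed)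
    then have "hinner H (psum c m \<ominus> psum c n) (psum c m \<ominus> psum c n) = complex_of_real (s n - s m)"
      using inner_partial_sums[OF that] inner_partial_sums[OF order_refl]
      by (simp add: inner_minus_left inner_minus_right minus_closed partial_sum_closed s_def)
    then show ?thesis
      using inner_self[OF minus_closed[OF partial_sum_closed partial_sum_closed]]
      by (metis of_real_eq_iff)
  qed
  have s: "Cauchy s"
    using c unfolding s_def by (simp add: summable_iff_convergent Cauchy_convergent_iff)
  have "\<exists>x\<in>carrier H. (\<lambda>n. hnorm H (psum c n \<ominus> x)) \<longlonglongrightarrow> 0"
  proof (rule complete)
    fix \<epsilon> :: real assume "\<epsilon> > 0"
    then obtain N where N: "\<And>m n. m \<ge> N \<Longrightarrow> n \<ge> N \<Longrightarrow> \<bar>s m - s n\<bar> < \<epsilon>\<^sup>2"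
      using CauchyD[OF s, of "\<epsilon>\<^sup>2"] by auto
    have ordered: "hnorm H (psum c m \<ominus> psum c n) < \<epsilon>" if "m \<ge> N" "n \<ge> N" "m \<le> n" for m n
    proof (rule power2_less_imp_less)
      show "(hnorm H (psum c m \<ominus> psum c n))\<^sup>2 < \<epsilon>\<^sup>2"
        using dist[OF that(3)] N[OF that(1,2)] by simp
    qed (use \<open>\<epsilon> > 0\<close> in simp)
    have "hnorm H (psum c m \<ominus> psum c n) < \<epsilon>" if "m \<ge> N" "n \<ge> N" for m n
      using ordered[of m n] ordered[of n m] that
        hnorm_minus_commute[OF partial_sum_closed partial_sum_closed, of c m c n]
      by (cases "m \<le> n") auto
    then show "\<exists>N. \<forall>m\<ge>N. \<forall>n\<ge>N. hnorm H (psum c m \<ominus> psum c n) < \<epsilon>" by blast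
  qed (rule partial_sum_closed)
  then obtain x where x: "x \<in> carrier H" and lim: "(\<lambda>n. hnorm H (psum c n \<ominus> x)) \<longlonglongrightarrow> 0" by auto
  have "coeff x j = c j" for j
  proof -
    have "(\<lambda>n. hinner H (psum c n) (h j)) \<longlonglongrightarrow> coeff x j"
      by (rule inner_tendsto_if_hnorm_tendsto[OF partial_sum_closed x h_carrier lim])
    moreover have "(\<lambda>n. hinner H (psum c n) (h j)) \<longlonglongrightarrow> c j"
      by (rule tendsto_eventually[OF eventually_mono[OF eventually_gt_at_top[of j]]])
        (simp add: inner_partial_sum_basis)
    ultimately show ?thesis by (rule LIMSEQ_unique)
  qed
  with x show ?thesis by auto
qed

end

section \<open>The space of square-summable sequences\<close>

text \<open>
  The only null set of counting measure is the empty set, so the equivalence classes in \<open>L2\<close> are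
  singletons.
\<close>

lemma l2_class_count_space: "l2_class (count_space UNIV) \<phi> = {\<phi>}"
  by (auto simp: l2_class_def AE_count_space)

lemma l2_rep_singleton: "l2_rep {\<phi>} = \<phi>"
  by (simp add: l2_rep_def)

lemma square_integrable_count_space:
  "square_integrable (count_space (UNIV :: nat set)) = {\<phi>. summable (\<lambda>n. (cmod (\<phi> n))\<^sup>2)}"
  by (auto simp: square_integrable_def integrable_count_space_nat_iff)

lemma carrier_L2: "carrier (L2 M) = l2_class M ` square_integrable M"
  by (simp add: L2_def)

lemma hinner_L2_count_space:
  assumes \<phi>: "summable (\<lambda>n. (cmod (\<phi> n))\<^sup>2)" and \<psi>: "summable (\<lambda>n. (cmod (\<psi> n))\<^sup>2)"
  shows "hinner (L2 (count_space (UNIV :: nat set))) {\<phi>} {\<psi>} = (\<Sum>n. \<phi> n * cnj (\<psi> n))"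
proof -
  have bound: "cmod (\<phi> n * cnj (\<psi> n)) \<le> (cmod (\<phi> n))\<^sup>2 + (cmod (\<psi> n))\<^sup>2" for n
  proof -
    have "0 \<le> cmod (\<phi> n) * cmod (\<psi> n)" by simp
    then show ?thesis
      using sum_squares_bound[of "cmod (\<phi> n)" "cmod (\<psi> n)"] unfolding norm_mult complex_mod_cnj
      by linarith
  qed
  have "summable (\<lambda>n. cmod (\<phi> n * cnj (\<psi> n)))"
    by (rule summable_comparison_test'[OF summable_add[OF \<phi> \<psi>], of 0])
      (use bound in simp)
  then have "integrable (count_space UNIV) (\<lambda>n. \<phi> n * cnj (\<psi> n))"
    by (simp add: integrable_count_space_nat_iff)
  then show ?thesis
    by (simp add: L2_def l2_rep_singleton integral_count_space_nat)
qed

context orthonormal_basis_sequence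
begin

definition expansion :: "'h \<Rightarrow> (nat \<Rightarrow> complex) set"
  where "expansion x = l2_class (count_space UNIV) (coeff x)"

lemma expansion_eq: "expansion x = {coeff x}"
  by (simp add: expansion_def l2_class_count_space)

text \<open>
  Parseval makes \<open>expansion\<close> isometric and Riesz-Fischer makes it onto; it is injective because the
  difference of two vectors with the same coefficients has norm zero.
\<close>

lemma unitary_expansion: "unitary H (L2 (count_space UNIV)) expansion"
proof -
  let ?K = "L2 (count_space (UNIV :: nat set))"
  have closed: "expansion x \<in> carrier ?K" if "x \<in> carrier H" for x
    unfolding expansion_def carrier_L2 square_integrable_count_space
    using coeff_square_summable[OF that] by (intro imageI CollectI)
  then have "linear_map H ?K expansion"
    by (simp add: linear_map_def)
      (simp add: expansion_eq L2_def l2_class_count_space l2_rep_singleton inner_add_left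
        inner_scale_left h_carrier)
  moreover have inner: "hinner ?K (expansion x) (expansion y) = hinner H x y"
    if "x \<in> carrier H" "y \<in> carrier H" for x y
    using that Parseval[OF that]
    by (simp add: expansion_eq hinner_L2_count_space coeff_square_summable sums_iff)
  moreover have "bij_betw expansion (carrier H) (carrier ?K)"
  proof (rule bij_betw_imageI)
    show "inj_on expansion (carrier H)"
    proof (rule inj_onI)
      fix x y assume x: "x \<in> carrier H" and y: "y \<in> carrier H" and eq: "expansion x = expansion y"
      have z: "x \<ominus> y \<in> carrier H" using x y by (rule minus_closed)
      have "coeff x n = coeff y n" for n
        using eq fun_cong[of "coeff x" "coeff y" n] by (simp add: expansion_eq)
      then have "coeff (x \<ominus> y) n = 0" for n
        using x y by (simp add: inner_minus_left h_carrier)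
      then have "(\<lambda>n. 0) sums hinner H (x \<ominus> y) (x \<ominus> y)"
        using Parseval[OF z z] by simp
      then have "hinner H (x \<ominus> y) (x \<ominus> y) = 0"
        by (simp add: sums_iff)
      then show "x = y" using eq_if_minus_eq_zero[OF x y] inner_eq_zero[OF z] by blast
    qed
    show "expansion ` carrier H = carrier ?K"
    proof
      show "expansion ` carrier H \<subseteq> carrier ?K"
        using closed by blast
      show "carrier ?K \<subseteq> expansion ` carrier H"
      proof
        fix F assume "F \<in> carrier ?K"
        then obtain \<phi> where "summable (\<lambda>n. (cmod (\<phi> n))\<^sup>2)" and F: "F = l2_class (count_space UNIV) \<phi>"
          unfolding carrier_L2 square_integrable_count_space by blast
        then obtain x where "x \<in> carrier H" "coeff x = \<phi>"
          using exists_vector_with_coefficients by blast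
        then show "F \<in> expansion ` carrier H" using F by (auto simp: expansion_def)
      qed
    qed
  qed
  ultimately show ?thesis by (simp add: unitary_def)
qed

end

section \<open>Transport of a representation along a unitary\<close>

lemma star_representation_transport:
  assumes H: "complex_vector_space H" and A: "cstar_algebra A"
    and rep: "star_representation A H \<pi>" and U: "unitary H K U"
  defines "\<rho> \<equiv> \<lambda>a y. U (\<pi> a (inv_into (carrier H) U y))"
  shows "star_representation A K \<rho>"
    and "x \<in> carrier H \<Longrightarrow> \<rho> a (U x) = U (\<pi> a x)"
proof -
  interpret complex_vector_space H by (rule H)
  have bij: "bij_betw U (carrier H) (carrier K)" using U by (simp add: unitary_def)
  then have range: "carrier K = U ` carrier H" by (simp add: bij_betw_imp_surj_on)
  show \<rho>_U: "\<rho> a (U x) = U (\<pi> a x)" if "x \<in> carrier H" for a x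
    using that bij by (simp add: \<rho>_def bij_betw_inv_into_left)
  have closed: "\<pi> a x \<in> carrier H" if "a \<in> carrier A" "x \<in> carrier H" for a x
    using that rep by (simp add: star_representation_def bounded_operator_def linear_map_def)
  have U_add: "U x \<oplus>\<^bsub>K\<^esub> U y = U (x \<oplus>\<^bsub>H\<^esub> y)" if "x \<in> carrier H" "y \<in> carrier H" for x y
    using that U by (simp add: unitary_def linear_map_def)
  have U_scale: "c \<odot>\<^bsub>K\<^esub> U x = U (c \<odot>\<^bsub>H\<^esub> x)" if "x \<in> carrier H" for c x
    using that U by (simp add: unitary_def linear_map_def)
  have U_inner: "hinner K (U x) (U y) = hinner H x y" if "x \<in> carrier H" "y \<in> carrier H" for x y
    using that U by (simp add: unitary_def)
  have U_norm: "hnorm K (U x) = hnorm H x" if "x \<in> carrier H" for x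
    using that by (simp add: hnorm_def U_inner)
  have bounded: "bounded_operator K (\<rho> a)" if a: "a \<in> carrier A" for a
  proof -
    have \<pi>a: "bounded_operator H (\<pi> a)" using rep a by (simp add: star_representation_def)
    then obtain C where C: "\<And>x. x \<in> carrier H \<Longrightarrow> hnorm H (\<pi> a x) \<le> C * hnorm H x"
      by (auto simp: bounded_operator_def)
    have "linear_map K K (\<rho> a)"
      using \<pi>a a by (simp add: linear_map_def bounded_operator_def range \<rho>_U U_add U_scale closed
          add_closed scale_closed)
    moreover have "\<forall>y\<in>carrier K. hnorm K (\<rho> a y) \<le> C * hnorm K y"
      using C a by (simp add: range \<rho>_U U_norm closed)
    ultimately show ?thesis by (auto simp: bounded_operator_def)
  qed
  have "is_adjoint K (\<rho> a) (\<rho> (star A a))" if a: "a \<in> carrier A" for a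
    using rep a cstar_algebra.star_closed[OF A a]
    by (simp add: star_representation_def is_adjoint_def range \<rho>_U U_inner closed)
  then show "star_representation A K \<rho>"
    using rep bounded
    by (simp add: star_representation_def range \<rho>_U U_add U_scale closed)
qed

section \<open>Projections and partial isometries in a representation\<close>

lemma (in cstar_algebra) projection_range_partial_isometry:
  assumes s: "partial_isometry A s" shows "projection A (s \<otimes>\<^bsub>A\<^esub> star A s)"
proof -
  have sc: "s \<in> carrier A" "star A s \<in> carrier A" "s \<otimes>\<^bsub>A\<^esub> star A s \<in> carrier A"
    and sss: "s \<otimes>\<^bsub>A\<^esub> star A s \<otimes>\<^bsub>A\<^esub> s = s"
    using s by (auto simp: partial_isometry_def star_closed mult_closed)
  have "s \<otimes>\<^bsub>A\<^esub> star A s \<otimes>\<^bsub>A\<^esub> (s \<otimes>\<^bsub>A\<^esub> star A s) = s \<otimes>\<^bsub>A\<^esub> star A s \<otimes>\<^bsub>A\<^esub> s \<otimes>\<^bsub>A\<^esub> star A s"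
    using mult_assoc[OF sc(3,1,2)] by simp
  then show ?thesis
    using sc sss by (simp add: projection_def star_mult star_star)
qed

locale hilbert_representation = alg: cstar_algebra A + hil: hilbert_space H
  for A :: "('a, 'm) cstar_scheme" and H :: "('h, 'n) hilb_scheme" +
  fixes \<pi> :: "'a \<Rightarrow> 'h \<Rightarrow> 'h"
  assumes rep: "star_representation A H \<pi>"
begin

lemma rep_closed: "\<lbrakk>a \<in> carrier A; x \<in> carrier H\<rbrakk> \<Longrightarrow> \<pi> a x \<in> carrier H"
  using rep by (simp add: star_representation_def bounded_operator_def linear_map_def)

lemma rep_mult:
  "\<lbrakk>a \<in> carrier A; b \<in> carrier A; x \<in> carrier H\<rbrakk> \<Longrightarrow> \<pi> (a \<otimes>\<^bsub>A\<^esub> b) x = \<pi> a (\<pi> b x)"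
  using rep by (simp add: star_representation_def)

lemma rep_adjoint:
  "\<lbrakk>a \<in> carrier A; x \<in> carrier H; y \<in> carrier H\<rbrakk>
    \<Longrightarrow> hinner H (\<pi> a x) y = hinner H x (\<pi> (star A a) y)"
  using rep by (simp add: star_representation_def is_adjoint_def)

lemma rep_zero: assumes x: "x \<in> carrier H" shows "\<pi> \<zero>\<^bsub>A\<^esub> x = \<zero>\<^bsub>H\<^esub>"
proof -
  have "\<pi> (0 \<odot>\<^bsub>A\<^esub> \<zero>\<^bsub>A\<^esub>) x = 0 \<odot>\<^bsub>H\<^esub> \<pi> \<zero>\<^bsub>A\<^esub> x"
    using rep x alg.zero_closed by (simp add: star_representation_def)
  then show ?thesis
    by (simp add: alg.scale_zero_left alg.zero_closed hil.scale_zero_left rep_closed x)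
qed

lemma rep_projection_fixes_basis:
  assumes q: "projection A q" and B: "orthonormal_basis H (\<pi> q ` carrier H) B" and b: "b \<in> B"
  shows "\<pi> q b = b"
proof -
  have "b \<in> \<pi> q ` carrier H"
    using B cspan.base[OF b] by (auto simp: orthonormal_basis_def hdense_in_def)
  then show ?thesis using q rep_mult[of q q] by (auto simp: projection_def)
qed

text \<open>
  For a self-adjoint \<open>q\<close>, \<open>\<parallel>q x\<parallel>\<^sup>2 = \<langle>x, q (q x)\<rangle>\<close>, and the right-hand side vanishes if \<open>x\<close> is orthogonal to
  the range of \<open>q\<close>.
\<close>

lemma rep_projection_kills_orthogonal:
  assumes q: "projection A q" and B: "orthonormal_basis H (\<pi> q ` carrier H) B"
    and x: "x \<in> carrier H" and orth: "\<And>b. b \<in> B \<Longrightarrow> hinner H x b = 0"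
  shows "\<pi> q x = \<zero>\<^bsub>H\<^esub>"
proof -
  have qc: "q \<in> carrier A" and star: "star A q = q" using q by (auto simp: projection_def)
  have qx: "\<pi> q x \<in> carrier H" using qc x by (rule rep_closed)
  have "hinner H x (\<pi> q (\<pi> q x)) = 0"
    using hil.orthogonal_basis_imp_orthogonal[OF x _ B orth] qc qx rep_closed by blast
  then have "hinner H (\<pi> q x) (\<pi> q x) = 0"
    using rep_adjoint[OF qc x qx] star by simp
  then show ?thesis using qx hil.inner_eq_zero by blast
qed

text \<open>A common basis vector would be a unit vector fixed by both projections, hence by their product.\<close>

lemma bases_of_orthogonal_projections_disjoint:
  assumes p: "projection A p" and q: "projection A q" and pq: "p \<otimes>\<^bsub>A\<^esub> q = \<zero>\<^bsub>A\<^esub>"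
    and B: "orthonormal_basis H (\<pi> p ` carrier H) B" and C: "orthonormal_basis H (\<pi> q ` carrier H) C"
  shows "B \<inter> C = {}"
proof (rule equals0I)
  fix b assume "b \<in> B \<inter> C"
  then have bB: "b \<in> B" and bC: "b \<in> C" by auto
  have b: "b \<in> carrier H" and unit: "hinner H b b = 1"
    using B bB by (auto simp: orthonormal_basis_def orthonormal_def)
  have "b = \<pi> p (\<pi> q b)"
    using rep_projection_fixes_basis[OF p B bB] rep_projection_fixes_basis[OF q C bC] by simp
  also have "\<dots> = \<zero>\<^bsub>H\<^esub>"
    using p q pq b rep_mult[of p q b] by (simp add: projection_def rep_zero)
  finally show False using unit b hil.inner_zero_left by simp
qed

text \<open>
  The kernel of \<open>\<pi> s\<^sup>*\<close> is the kernel of the range projection \<open>\<pi> (s s\<^sup>*)\<close>, since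
  \<open>\<parallel>s\<^sup>* x\<parallel>\<^sup>2 = \<langle>x, s s\<^sup>* x\<rangle>\<close>.
\<close>

lemma rep_star_kills_orthogonal:
  assumes s: "partial_isometry A s"
    and B: "orthonormal_basis H (\<pi> (s \<otimes>\<^bsub>A\<^esub> star A s) ` carrier H) B"
    and x: "x \<in> carrier H" and orth: "\<And>b. b \<in> B \<Longrightarrow> hinner H x b = 0"
  shows "\<pi> (star A s) x = \<zero>\<^bsub>H\<^esub>"
proof -
  have sc: "s \<in> carrier A" "star A s \<in> carrier A"
    using s by (auto simp: partial_isometry_def alg.star_closed)
  have y: "\<pi> (star A s) x \<in> carrier H" using sc(2) x by (rule rep_closed)
  have "\<pi> s (\<pi> (star A s) x) = \<zero>\<^bsub>H\<^esub>"
    using rep_projection_kills_orthogonal[OF alg.projection_range_partial_isometry[OF s] B x orth]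
      rep_mult[OF sc x] by simp
  then have "hinner H (\<pi> (star A s) x) (\<pi> (star A s) x) = 0"
    using rep_adjoint[OF sc(2) x y] sc(1) x by (simp add: alg.star_star hil.inner_zero_right)
  then show ?thesis using y hil.inner_eq_zero by blast
qed

end

section \<open>Bijections and counting measure\<close>

lemma is_RN_derivative_count_space:
  assumes "inj_on f D"
  shows "is_RN_derivative (count_space UNIV) D f (\<lambda>_. 1)"
proof -
  have "emeasure (count_space UNIV) (f ` B) = emeasure (count_space D) B" if "B \<subseteq> D" for B
    using that inj_on_subset[OF assms that]
    by (simp add: emeasure_count_space finite_image_iff card_image)
  then show ?thesis
    by (auto simp: is_RN_derivative_def restrict_count_space density_1)
qed

lemma ae_eq_set_count_space: "ae_eq_set (count_space UNIV) A B \<longleftrightarrow> A = B"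
  by (auto simp: ae_eq_set_def ae_subset_def null_sets_count_space)

lemma ae_subset_count_space: "ae_subset (count_space UNIV) A B \<longleftrightarrow> A \<subseteq> B"
  by (auto simp: ae_subset_def null_sets_count_space)

lemma ae_eq_map_count_space: "ae_eq_map (count_space UNIV) D f g \<longleftrightarrow> (\<forall>x\<in>D. f x = g x)"
  by (auto simp: ae_eq_map_def null_sets_count_space)

section \<open>The branching system of a basis permuted by the representation\<close>


theorem theorem2p1:
  fixes E :: "('v, 'e) pre_digraph"
    and A :: "'a cstar" and P :: "'v \<Rightarrow> 'a" and S :: "'e \<Rightarrow> 'a"
    and H :: "'h hilb" and \<pi> :: "'a \<Rightarrow> 'h \<Rightarrow> 'h"
    and He Be :: "'e \<Rightarrow> 'h set" and Hv Bv :: "'v \<Rightarrow> 'h set"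
    and h :: "nat \<Rightarrow> 'h"
  assumes graph: "wf_digraph E" "countable (verts E)" "countable (arcs E)"
    and universal: "graph_cstar_algebra E A P S"
    and hilbert: "hilbert_space H" "separable H"
    and rep: "star_representation A H \<pi>"
    and He_def: "\<And>e. e \<in> arcs E \<Longrightarrow> He e = (\<lambda>x. \<pi> (S e) (\<pi> (star A (S e)) x)) ` carrier H"
    and Hv_def: "\<And>v. v \<in> verts E \<Longrightarrow> Hv v = \<pi> (P v) ` carrier H"
    and Be_basis: "\<And>e. e \<in> arcs E \<Longrightarrow> orthonormal_basis H (He e) (Be e)"
    and Bv_basis: "\<And>v. v \<in> verts E \<Longrightarrow> orthonormal_basis H (Hv v) (Bv v)"
    and h_basis: "inj h" "orthonormal_basis H (carrier H) (range h)"
    and finite_emitter: "\<And>v. \<lbrakk>v \<in> verts E; finite (out_arcs E v); out_arcs E v \<noteq> {}\<rbrakk>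
          \<Longrightarrow> Bv v = (\<Union>e\<in>out_arcs E v. Be e)"
    and infinite_emitter: "\<And>v e. \<lbrakk>v \<in> verts E; infinite (out_arcs E v); e \<in> out_arcs E v\<rbrakk>
          \<Longrightarrow> Be e \<subseteq> Bv v"
    and Bv_subset: "\<And>v. v \<in> verts E \<Longrightarrow> Bv v \<subseteq> range h"
    and permute: "\<And>e. e \<in> arcs E \<Longrightarrow> \<pi> (S e) ` Bv (head E e) = Be e"
  shows "\<exists>R D f g \<Phi> \<Psi> \<rho>.
    branching_system E (count_space (UNIV :: nat set)) R D f g \<Phi> \<Psi> \<and>
    induced_representation E A P S (count_space UNIV) R D g \<Psi> \<rho> \<and>
    unitarily_equivalent A H \<pi> (L2 (count_space (UNIV :: nat set))) \<rho>"
proof -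
  let ?N = "count_space (UNIV :: nat set)"
  have alg: "cstar_algebra A" and ck: "cuntz_krieger_family E A P S"
    using universal by (auto simp: graph_cstar_algebra_def)
  interpret wf_digraph E by (rule graph(1))
  interpret hilbert_space H by (rule hilbert(1))
  interpret orthonormal_basis_sequence H h by unfold_locales (rule h_basis)+
  interpret hilbert_representation A H \<pi>
    by (rule hilbert_representation.intro[OF alg hilbert(1)]) (unfold_locales, rule rep)

  have P_proj: "projection A (P v)" if "v \<in> verts E" for v
    using that ck by (simp add: cuntz_krieger_family_def)
  have P_orth: "P u \<otimes>\<^bsub>A\<^esub> P v = \<zero>\<^bsub>A\<^esub>" if "u \<in> verts E" "v \<in> verts E" "u \<noteq> v" for u v
    using that ck by (simp add: cuntz_krieger_family_def)
  have S_iso: "partial_isometry A (S e)" if "e \<in> arcs E" for e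
    using that ck by (simp add: cuntz_krieger_family_def)
  have S_orth: "(S e \<otimes>\<^bsub>A\<^esub> star A (S e)) \<otimes>\<^bsub>A\<^esub> (S d \<otimes>\<^bsub>A\<^esub> star A (S d)) = \<zero>\<^bsub>A\<^esub>"
    if "e \<in> arcs E" "d \<in> arcs E" "e \<noteq> d" for e d
    using that ck by (simp add: cuntz_krieger_family_def)
  have S_source: "star A (S e) \<otimes>\<^bsub>A\<^esub> S e = P (head E e)" if "e \<in> arcs E" for e
    using that ck by (simp add: cuntz_krieger_family_def)
  have S_closed: "S e \<in> carrier A" "star A (S e) \<in> carrier A" if "e \<in> arcs E" for e
    using S_iso[OF that] by (simp_all add: partial_isometry_def alg.star_closed)
  have P_closed: "P v \<in> carrier A" and P_star: "star A (P v) = P v" if "v \<in> verts E" for v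
    using P_proj[OF that] by (simp_all add: projection_def)

  have Bv: "orthonormal_basis H (\<pi> (P v) ` carrier H) (Bv v)" if "v \<in> verts E" for v
    using Bv_basis[OF that] Hv_def[OF that] by simp
  have Be: "orthonormal_basis H (\<pi> (S e \<otimes>\<^bsub>A\<^esub> star A (S e)) ` carrier H) (Be e)"
    if "e \<in> arcs E" for e
  proof -
    have "\<pi> (S e \<otimes>\<^bsub>A\<^esub> star A (S e)) ` carrier H = He e"
      unfolding He_def[OF that]
      by (rule image_cong) (simp_all add: rep_mult S_closed[OF that])
    then show ?thesis using Be_basis[OF that] by simp
  qed
  \<comment> \<open>The source of \<open>e\<close> emits \<open>e\<close>, so one of the two compatibility conditions applies to it.\<close>
  have Be_Bv: "Be e \<subseteq> Bv (tail E e)" if "e \<in> arcs E" for e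
    using that finite_emitter[of "tail E e"] infinite_emitter[of "tail E e" e]
    by (cases "finite (out_arcs E (tail E e))") (auto simp: out_arcs_def)

  define D where "D v = {n. h n \<in> Bv v}" for v
  define R where "R e = {n. h n \<in> Be e}" for e
  define f where "f e n = inv h (\<pi> (S e) (h n))" for e n
  define g where "g e = inv_into (D (head E e)) (f e)" for e

  \<comment> \<open>\<open>S e\<^sup>* S e = P (r e)\<close>, and \<open>\<pi> (P (r e))\<close> fixes the basis of its range.\<close>
  have S_star_S: "\<pi> (star A (S e)) (\<pi> (S e) (h n)) = h n"
    if e: "e \<in> arcs E" and n: "n \<in> D (head E e)" for e n
  proof -
    have v: "head E e \<in> verts E" using e by simp
    have "\<pi> (star A (S e)) (\<pi> (S e) (h n)) = \<pi> (P (head E e)) (h n)"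
      using rep_mult[OF S_closed(2,1)[OF e] h_carrier] S_source[OF e] by simp
    also have "\<dots> = h n"
      using rep_projection_fixes_basis[OF P_proj[OF v] Bv[OF v]] n by (simp add: D_def)
    finally show ?thesis .
  qed
  have Be_h: "Be e \<subseteq> range h" if "e \<in> arcs E" for e
    using Be_Bv[OF that] Bv_subset[of "tail E e"] that by auto
  have h_f: "h (f e n) = \<pi> (S e) (h n)" and f_R: "f e n \<in> R e"
    if e: "e \<in> arcs E" and n: "n \<in> D (head E e)" for e n
  proof -
    have img: "\<pi> (S e) (h n) \<in> Be e" using permute[OF e] n by (auto simp: D_def)
    then show "h (f e n) = \<pi> (S e) (h n)"
      using Be_h[OF e] by (auto simp: f_def intro: f_inv_into_f)
    then show "f e n \<in> R e" using img by (simp add: R_def)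
  qed
  have f_inj: "inj_on (f e) (D (head E e))" if e: "e \<in> arcs E" for e
  proof (rule inj_onI)
    fix m n assume m: "m \<in> D (head E e)" and n: "n \<in> D (head E e)" and "f e m = f e n"
    then have "\<pi> (S e) (h m) = \<pi> (S e) (h n)" using h_f[OF e] by metis
    then have "h m = h n" using S_star_S[OF e m] S_star_S[OF e n] by metis
    then show "m = n" using h_basis(1) by (simp add: inj_eq)
  qed
  have f_onto: "f e ` D (head E e) = R e" if e: "e \<in> arcs E" for e
  proof
    show "f e ` D (head E e) \<subseteq> R e" using f_R[OF e] by blast
    show "R e \<subseteq> f e ` D (head E e)"
    proof
      fix n assume "n \<in> R e"
      then obtain x where x: "x \<in> Bv (head E e)" and hn: "h n = \<pi> (S e) x"
        using permute[OF e] by (auto simp: R_def)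
      obtain m where m: "x = h m" using x Bv_subset[of "head E e"] e by auto
      then have mD: "m \<in> D (head E e)" using x by (simp add: D_def)
      have "h (f e m) = h n" using h_f[OF e mD] hn m by simp
      then show "n \<in> f e ` D (head E e)" using mD h_basis(1) by (auto simp: inj_eq)
    qed
  qed
  have f_bij: "bij_betw (f e) (D (head E e)) (R e)" if "e \<in> arcs E" for e
    using f_inj[OF that] f_onto[OF that] by (simp add: bij_betw_def)
  have g_bij: "bij_betw (g e) (R e) (D (head E e))" if "e \<in> arcs E" for e
    unfolding g_def using f_bij[OF that] by (rule bij_betw_inv_into)
  have g_D: "g e n \<in> D (head E e)" and f_g: "f e (g e n) = n"
    if "e \<in> arcs E" "n \<in> R e" for e n
    using that bij_betwE[OF g_bij] bij_betw_inv_into_right[OF f_bij] by (auto simp: g_def)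

  have "branching_system E ?N R D f g (\<lambda>_ _. 1) (\<lambda>_ _. 1)"
  proof
    show "ae_eq_set ?N (R e \<inter> R d) {}" if "e \<in> arcs E" "d \<in> arcs E" "d \<noteq> e" for e d
      using bases_of_orthogonal_projections_disjoint[OF
          alg.projection_range_partial_isometry[OF S_iso[OF that(1)]]
          alg.projection_range_partial_isometry[OF S_iso[OF that(2)]]
          S_orth[OF that(1,2)] Be[OF that(1)] Be[OF that(2)]] that(3)
      by (auto simp: ae_eq_set_count_space R_def)
    show "ae_eq_set ?N (D u \<inter> D v) {}" if "u \<in> verts E" "v \<in> verts E" "u \<noteq> v" for u v
      using bases_of_orthogonal_projections_disjoint[OF P_proj[OF that(1)] P_proj[OF that(2)]
          P_orth[OF that] Bv[OF that(1)] Bv[OF that(2)]]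
      by (auto simp: ae_eq_set_count_space D_def)
    show "ae_subset ?N (R e) (D (tail E e))" if "e \<in> arcs E" for e
      using Be_Bv[OF that] by (auto simp: ae_subset_count_space R_def D_def)
    show "ae_eq_set ?N (D v) (\<Union>e\<in>out_arcs E v. R e)"
      if "v \<in> verts E" "finite (out_arcs E v)" "out_arcs E v \<noteq> {}" for v
      using finite_emitter[OF that] by (auto simp: ae_eq_set_count_space R_def D_def)
    show "f e \<in> D (head E e) \<rightarrow> R e" if "e \<in> arcs E" for e
      using f_R[OF that] by auto
    show "ae_eq_set ?N (f e ` D (head E e)) (R e)" if "e \<in> arcs E" for e
      using f_onto[OF that] by (simp add: ae_eq_set_count_space)
    show "is_RN_derivative ?N (D (head E e)) (f e) (\<lambda>_. 1)" if "e \<in> arcs E" for e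
      using f_inj[OF that] by (rule is_RN_derivative_count_space)
    show "g e \<in> R e \<rightarrow> D (head E e)" if "e \<in> arcs E" for e
      using g_D[OF that] by auto
    show "ae_eq_map ?N (R e) (f e \<circ> g e) id" if "e \<in> arcs E" for e
      using f_g[OF that] by (simp add: ae_eq_map_count_space)
    show "ae_eq_map ?N (D (head E e)) (g e \<circ> f e) id" if "e \<in> arcs E" for e
      using f_inj[OF that] by (simp add: ae_eq_map_count_space g_def)
    show "is_RN_derivative ?N (R e) (g e) (\<lambda>_. 1)" if "e \<in> arcs E" for e
      using bij_betw_imp_inj_on[OF g_bij[OF that]] by (rule is_RN_derivative_count_space)
  qed auto

  moreover define \<rho> where "\<rho> = (\<lambda>a y. expansion (\<pi> a (inv_into (carrier H) expansion y)))"
  have \<rho>_rep: "star_representation A (L2 ?N) \<rho>"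
    and \<rho>_expansion: "\<And>a x. x \<in> carrier H \<Longrightarrow> \<rho> a (expansion x) = expansion (\<pi> a x)"
    unfolding \<rho>_def
    using star_representation_transport[OF complex_vector_space_axioms alg rep unitary_expansion]
    by auto

  moreover have "induced_representation E A P S ?N R D g (\<lambda>_ _. 1) \<rho>"
    unfolding induced_representation_def
  proof (intro conjI ballI \<rho>_rep)
    fix \<phi> assume "\<phi> \<in> square_integrable ?N"
    then obtain x where x: "x \<in> carrier H" and x\<phi>: "coeff x = \<phi>"
      using exists_vector_with_coefficients by (auto simp: square_integrable_count_space)
    have class_\<phi>: "l2_class ?N \<phi> = expansion x" by (simp add: expansion_def x\<phi>)
    have x_h: "hinner H x (h n) = \<phi> n" for n using fun_cong[OF x\<phi>] .
    {
      fix e assume e: "e \<in> arcs E"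
      have "coeff (\<pi> (S e) x) n = indicator (R e) n * complex_of_real (sqrt 1) * \<phi> (g e n)" for n
      proof (cases "n \<in> R e")
        case True
        have "\<pi> (star A (S e)) (h n) = h (g e n)"
          using h_f[OF e g_D[OF e True]] f_g[OF e True] S_star_S[OF e g_D[OF e True]] by simp
        then show ?thesis
          using True rep_adjoint[OF S_closed(1)[OF e] x h_carrier] x_h by simp
      next
        case False
        have "hinner H (h n) b = 0" if b: "b \<in> Be e" for b
          using b Be_h[OF e] False by (auto simp: R_def inner_h_h)
        then have "\<pi> (star A (S e)) (h n) = \<zero>\<^bsub>H\<^esub>"
          using rep_star_kills_orthogonal[OF S_iso[OF e] Be[OF e] h_carrier] by blast
        then show ?thesis
          using False rep_adjoint[OF S_closed(1)[OF e] x h_carrier] x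
          by (simp add: inner_zero_right)
      qed
      then show "\<rho> (S e) (l2_class ?N \<phi>)
          = l2_class ?N (\<lambda>n. indicator (R e) n * complex_of_real (sqrt 1) * \<phi> (g e n))"
        unfolding class_\<phi> \<rho>_expansion[OF x] by (simp add: expansion_def)
    next
      fix v assume v: "v \<in> verts E"
      have "coeff (\<pi> (P v) x) n = indicator (D v) n * \<phi> n" for n
      proof (cases "n \<in> D v")
        case True
        then have "\<pi> (P v) (h n) = h n"
          using rep_projection_fixes_basis[OF P_proj[OF v] Bv[OF v]] by (simp add: D_def)
        then show ?thesis
          using True rep_adjoint[OF P_closed[OF v] x h_carrier] P_star[OF v] x_h by simp
      next
        case False
        have "hinner H (h n) b = 0" if b: "b \<in> Bv v" for b
          using b Bv_subset[OF v] False by (auto simp: D_def inner_h_h)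
        then have "\<pi> (P v) (h n) = \<zero>\<^bsub>H\<^esub>"
          using rep_projection_kills_orthogonal[OF P_proj[OF v] Bv[OF v] h_carrier] by blast
        then show ?thesis
          using False rep_adjoint[OF P_closed[OF v] x h_carrier] P_star[OF v] x
          by (simp add: inner_zero_right)
      qed
      then show "\<rho> (P v) (l2_class ?N \<phi>) = l2_class ?N (\<lambda>n. indicator (D v) n * \<phi> n)"
        unfolding class_\<phi> \<rho>_expansion[OF x] by (simp add: expansion_def)
    }
  qed

  moreover have "unitarily_equivalent A H \<pi> (L2 ?N) \<rho>"
    unfolding unitarily_equivalent_def using unitary_expansion \<rho>_expansion by metis
  ultimately show ?thesis by blast
qed

end
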